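(* Every relative equilibrium associated to an acute triangle fixed-point configuration is Lyapunov stable on $\mathbb S^1$. Explicitly: let $m_1,m_2,m_3>0$, let $(\alpha,\beta)$ with $0<\alpha<\pi$, $0<\beta<\pi$, $\pi<\alpha+\beta<2\pi$ be such that the configuration with $m_1,m_2,m_3$ on the equator at longitudes $0,\alpha,\alpha+\beta$ is a fixed point, and let $\omega\neq0$. Then the point $X_1=(\phi_1,\phi_2,p_{\phi_1},p_{\phi_2})=(\alpha,\ \beta+\nu_1\alpha,\ 0,\ 0)$ is a Lyapunov stable equilibrium of the Hamiltonian system on $\{(\phi_1,\phi_2,p_{\phi_1},p_{\phi_2})\}$ with symplectic form $dp_{\phi_1}\wedge d\phi_1+dp_{\phi_2}\wedge d\phi_2$ and Hamiltonian $$H_{\bar m\omega}=\frac12\Big(\frac{p_{\phi_1}^2}{\nu_3}+\frac{p_{\phi_2}^2}{\nu_4}\Big)-V(\phi_1,\phi_2)+\frac{\bar m\omega^2}{2}.$$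
   Context: On the unit sphere, masses on the equator at longitudes $\varphi_i$ have geodesic distances $d_{ij}\in(0,\pi)$; the force function is $V=\sum_{i<j}m_im_j\cot d_{ij}$ and a fixed point is a critical point of $V$ (on the configuration space of $(\mathbb S^2)^3$ with $d_{ij}\notin\{0,\pi\}$). The associated relative equilibrium is the motion $\theta_i(t)=\pi/2$, $\varphi_i(t)=\varphi_i(0)+\omega t$ (uniform rotation of the fixed point about the $z$-axis). Restricted to the equator the Hamiltonian is $\sum_i\frac{p_{\varphi_i}^2}{2m_i}-V$, and the angular momentum is $p_{\varphi_1}+p_{\varphi_2}+p_{\varphi_3}$, equal to $\bar m\omega$ along the relative equilibrium. Jacobi-type coordinates: $\bar m=m_1+m_2+m_3$, $\nu_1=\frac{m_1}{m_1+m_2}$, $\nu_2=\frac{m_2}{m_1+m_2}$, $\nu_3=\frac{m_1m_2}{m_1+m_2}$, $\nu_4=\frac{(m_1+m_2)m_3}{\bar m}$, $\phi_1=\varphi_2-\varphi_1$, $\phi_2=\varphi_3-\nu_1\varphi_1-\nu_2\varphi_2$, $p_{\phi_1}=\nu_3\dot\phi_1$, $p_{\phi_2}=\nu_4\dot\phi_2$; in these variables $V(\phi_1,\phi_2)=m_1m_2\cot\phi_1+m_2m_3\cot(\phi_2-\nu_1\phi_1)-m_1m_3\cot(\phi_2+\nu_2\phi_1)$. The system with Hamiltonian $H_{\bar m\omega}$ is the reduction of the equatorial problem to angular momentum $\bar m\omega$ modulo rotations; by definition, the relative equilibrium is Lyapunov stable on $\mathbb S^1$ if the corresponding rest point $X_1$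 of this reduced system is Lyapunov stable. *)

theory Defs
  imports "HOL-Analysis.Analysis"
begin

type_synonym pt3 = "real \<times> real \<times> real"
type_synonym cfg = "pt3 \<times> pt3 \<times> pt3"

definition geod_dist :: "pt3 \<Rightarrow> pt3 \<Rightarrow> real" where
  "geod_dist a b = arccos (a \<bullet> b)"

definition config_space :: "cfg set" where
  "config_space = {(x1, x2, x3). norm x1 = 1 \<and> norm x2 = 1 \<and> norm x3 = 1 \<and>
     geod_dist x1 x2 \<notin> {0, pi} \<and> geod_dist x1 x3 \<notin> {0, pi} \<and> geod_dist x2 x3 \<notin> {0, pi}}"

definition force_fun :: "real \<Rightarrow> real \<Rightarrow> real \<Rightarrow> cfg \<Rightarrow> real" where
  "force_fun m1 m2 m3 x = (case x of (x1, x2, x3) \<Rightarrow>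
      m1 * m2 * cot (geod_dist x1 x2) + m1 * m3 * cot (geod_dist x1 x3)
    + m2 * m3 * cot (geod_dist x2 x3))"

text \<open>Fixed point = critical point of V on the configuration space (a submanifold of R^9):
  the derivative of V along every differentiable curve in the configuration space through
  the point vanishes.\<close>
definition fixed_point :: "real \<Rightarrow> real \<Rightarrow> real \<Rightarrow> cfg \<Rightarrow> bool" where
  "fixed_point m1 m2 m3 x \<longleftrightarrow> x \<in> config_space \<and>
     (\<forall>(\<gamma> :: real \<Rightarrow> cfg) e. e > 0 \<longrightarrow> (\<forall>t \<in> {-e<..<e}. \<gamma> t \<in> config_space) \<longrightarrow>
        \<gamma> 0 = x \<longrightarrow> \<gamma> differentiable (at 0) \<longrightarrow>
        ((force_fun m1 m2 m3 \<circ> \<gamma>) has_real_derivative 0) (at 0))"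

definition equator_pt :: "real \<Rightarrow> pt3" where
  "equator_pt \<phi> = (cos \<phi>, sin \<phi>, 0)"

type_synonym state = "real \<times> real \<times> real \<times> real"  (* (phi1, phi2, p_phi1, p_phi2) *)

definition mbar :: "real \<Rightarrow> real \<Rightarrow> real \<Rightarrow> real" where
  "mbar m1 m2 m3 = m1 + m2 + m3"
definition nu1 :: "real \<Rightarrow> real \<Rightarrow> real" where "nu1 m1 m2 = m1 / (m1 + m2)"
definition nu2 :: "real \<Rightarrow> real \<Rightarrow> real" where "nu2 m1 m2 = m2 / (m1 + m2)"
definition nu3 :: "real \<Rightarrow> real \<Rightarrow> real" where "nu3 m1 m2 = m1 * m2 / (m1 + m2)"
definition nu4 :: "real \<Rightarrow> real \<Rightarrow> real \<Rightarrow> real" where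
  "nu4 m1 m2 m3 = (m1 + m2) * m3 / mbar m1 m2 m3"

definition V_red :: "real \<Rightarrow> real \<Rightarrow> real \<Rightarrow> real \<Rightarrow> real \<Rightarrow> real" where
  "V_red m1 m2 m3 \<phi>1 \<phi>2 = m1 * m2 * cot \<phi>1 + m2 * m3 * cot (\<phi>2 - nu1 m1 m2 * \<phi>1)
      - m1 * m3 * cot (\<phi>2 + nu2 m1 m2 * \<phi>1)"

text \<open>Phase space of the reduced system: where V is defined (no collisions/antipodal pairs).\<close>
definition red_domain :: "real \<Rightarrow> real \<Rightarrow> state set" where
  "red_domain m1 m2 = {(\<phi>1, \<phi>2, p1, p2). sin \<phi>1 \<noteq> 0 \<and> sin (\<phi>2 - nu1 m1 m2 * \<phi>1) \<noteq> 0
      \<and> sin (\<phi>2 + nu2 m1 m2 * \<phi>1) \<noteq> 0}"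

definition H_red :: "real \<Rightarrow> real \<Rightarrow> real \<Rightarrow> real \<Rightarrow> state \<Rightarrow> real" where
  "H_red m1 m2 m3 \<omega> z = (case z of (\<phi>1, \<phi>2, p1, p2) \<Rightarrow>
     (p1\<^sup>2 / nu3 m1 m2 + p2\<^sup>2 / nu4 m1 m2 m3) / 2 - V_red m1 m2 m3 \<phi>1 \<phi>2
     + mbar m1 m2 m3 * \<omega>\<^sup>2 / 2)"

text \<open>Hamiltonian vector field for the symplectic form dp1 ^ dq1 + dp2 ^ dq2,
  state (q1, q2, p1, p2): q' = dH/dp, p' = - dH/dq.\<close>
definition ham_field :: "(state \<Rightarrow> real) \<Rightarrow> state \<Rightarrow> state" where
  "ham_field H z = (case z of (q1, q2, p1, p2) \<Rightarrow>
     ( deriv (\<lambda>s. H (q1, q2, s, p2)) p1,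
       deriv (\<lambda>s. H (q1, q2, p1, s)) p2,
       - deriv (\<lambda>s. H (s, q2, p1, p2)) q1,
       - deriv (\<lambda>s. H (q1, s, p1, p2)) q2))"

definition is_solution :: "(state \<Rightarrow> state) \<Rightarrow> state set \<Rightarrow> real set \<Rightarrow> (real \<Rightarrow> state) \<Rightarrow> bool" where
  "is_solution f D I x \<longleftrightarrow> (\<forall>t \<in> I. x t \<in> D \<and> (x has_vector_derivative f (x t)) (at t within I))"

definition lyapunov_stable :: "(state \<Rightarrow> state) \<Rightarrow> state set \<Rightarrow> state \<Rightarrow> bool" where
  "lyapunov_stable f D z0 \<longleftrightarrow> z0 \<in> D \<and> f z0 = 0 \<and>
     (\<forall>\<epsilon> > 0. \<exists>\<delta> > 0. \<forall>y \<in> D. dist y z0 < \<delta> \<longrightarrow>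
        (\<exists>x. is_solution f D {0..} x \<and> x 0 = y) \<and>
        (\<forall>T x. is_solution f D {0..T} x \<longrightarrow> x 0 = y \<longrightarrow> (\<forall>t \<in> {0..T}. dist (x t) z0 < \<epsilon>)))"

end

theory Submission
  imports Defs
begin

text \<open>The fixed-point equations on the equator say \<open>m1 m2 / sin\<^sup>2 \<alpha> = m2 m3 / sin\<^sup>2 \<beta> = m1 m3 / sin\<^sup>2 (\<alpha> + \<beta>)\<close>.
  Substituting this into \<open>V\<close>, and writing \<open>x = cot a\<close>, \<open>y = cot b\<close>, \<open>s = x + y < 0\<close> (and
  \<open>x\<^sub>0, y\<^sub>0, s\<^sub>0\<close> at the fixed point), the difference \<open>s (V(a, b) - V(\<alpha>, \<beta>))\<close> is a positive multiple of
  \<open>(s - s\<^sub>0)\<^sup>2 + (y\<^sub>0 x - x\<^sub>0 y)\<^sup>2\<close>; this is the Neuberg-Pedoe inequality for the triangle with angles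
  \<open>\<pi> - a\<close>, \<open>\<pi> - b\<close>, \<open>a + b - \<pi>\<close>. Hence \<open>V\<close> has a strict maximum and the Hamiltonian a strict minimum at
  the rest point, and stability follows from conservation of energy (Lagrange-Dirichlet).\<close>

section \<open>Global solutions of Lipschitz differential equations\<close>

lemma integral_has_vector_derivative_halfline:
  fixes f :: "real \<Rightarrow> 'a::banach"
  assumes "continuous_on {a..} f" "a \<le> t"
  shows "((\<lambda>u. integral {a..u} f) has_vector_derivative f t) (at t within {a..})"
proof -
  \<comment> \<open>The endpoint t + 1 keeps t off the right end, so that near t the interval and
    the half-line coincide.\<close>
  have "((\<lambda>u. integral {a..u} f) has_vector_derivative f t) (at t within {a..t+1})"
    by (rule integral_has_vector_derivative)
      (use assms in \<open>auto intro: continuous_on_subset\<close>)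
  moreover have "at t within {a..t+1} = at t within {a..}"
    by (rule at_within_nhd[where S = "{..<t+1}"]) auto
  ultimately show ?thesis by simp
qed

text \<open>Integrating \<open>exp (k * s)\<close> gains a factor 1/k. For k = 2L this factor turns
  the Lipschitz constant L into the contraction constant 1/2.\<close>

lemma norm_integral_le_exp:
  fixes h :: "real \<Rightarrow> 'a::banach"
  assumes "0 < k" "0 \<le> t" "0 \<le> c"
    and h: "continuous_on {0..t} h" "\<And>s. s \<in> {0..t} \<Longrightarrow> norm (h s) \<le> c * exp (k * s)"
  shows "norm (integral {0..t} h) \<le> c / k * exp (k * t)"
proof -
  have I: "((\<lambda>s. c * exp (k * s)) has_integral (c / k * exp (k * t) - c / k * exp (k * 0))) {0..t}"
    using assms(1,2)
    by (intro fundamental_theorem_of_calculus)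
      (auto intro!: derivative_eq_intros simp flip: has_real_derivative_iff_has_vector_derivative)
  have "norm (integral {0..t} h) \<le> integral {0..t} (\<lambda>s. c * exp (k * s))"
    using h I by (intro integral_norm_bound_integral)
      (auto intro!: integrable_continuous_real continuous_intros)
  also have "\<dots> = c / k * exp (k * t) - c / k * exp (k * 0)"
    using I by (rule integral_unique)
  finally show ?thesis using assms by (auto simp: divide_nonneg_pos intro: order_trans)
qed

text \<open>In the norm weighted by \<open>exp (-2Lt)\<close> the Picard operator is a contraction on the whole half-line,
  so no local solutions have to be glued. The fixed point is sought in the form
  \<open>x t = y + exp (2Lt) u t\<close> with \<open>u\<close> bounded; clamping \<open>t\<close> at 0 makes \<open>u\<close> a function on
  the whole real line.\<close>
lemma lipschitz_ode_global_solution: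
  fixes g :: "'a::banach \<Rightarrow> 'a"
  assumes "M-lipschitz_on UNIV g"
  obtains x where "x 0 = y" "\<And>t. 0 \<le> t \<Longrightarrow> (x has_vector_derivative g (x t)) (at t within {0..})"
proof -
  \<comment> \<open>M may be 0; the maximum makes the rate 2L positive.\<close>
  define L where "L = max M 1"
  have L: "L > 0" and gL: "norm (g a - g b) \<le> L * norm (a - b)" for a b
    using lipschitz_on_mono[OF assms subset_refl, of L]
    by (auto simp: L_def dest!: lipschitz_onD[where x = a and y = b] simp: dist_norm)
  have gcont: "continuous_on UNIV g"
    using assms by (rule lipschitz_on_continuous_on)
  define E where "E t = exp (2 * L * t)" for t
  have E: "E t > 0" for t by (simp add: E_def)
  have contE: "continuous_on A E" for A by (auto simp: E_def intro!: continuous_intros)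
  define h where "h u s = g (y + E s *\<^sub>R apply_bcontfun u s)" for u :: "real \<Rightarrow>\<^sub>C 'a" and s
  have hcont: "continuous_on A (h u)" for A u
    unfolding h_def
    by (rule continuous_on_compose2[OF gcont])
      (auto intro!: continuous_intros contE)
  have hder: "((\<lambda>t. integral {0..t} (h u)) has_vector_derivative h u t) (at t within {0..})"
    if "0 \<le> t" for t u
    using that by (intro integral_has_vector_derivative_halfline hcont)
  \<comment> \<open>The Picard operator rewritten for u: integrate the field along x, then divide by
    the weight E.\<close>
  define P where "P u t = (1 / E (max 0 t)) *\<^sub>R integral {0..max 0 t} (h u)" for u t
  have Pcont: "continuous_on UNIV (P u)" for u
  proof -
    have "continuous_on {0..} (\<lambda>t. (1 / E t) *\<^sub>R integral {0..t} (h u))"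
      using hder[of _ u] E
      by (intro continuous_intros contE)
        (auto simp: less_imp_neq[symmetric] continuous_on_eq_continuous_within
          intro: has_vector_derivative_continuous)
    then show ?thesis unfolding P_def
      by (rule continuous_on_compose2) (auto intro!: continuous_intros)
  qed
  have Pbound: "bounded (range (P u))" for u
  proof -
    obtain B where B: "norm (apply_bcontfun u t) \<le> B" for t
      using bounded_apply_bcontfun[of u] unfolding bounded_iff by auto
    have B0: "B \<ge> 0" using B[of 0] norm_ge_zero order_trans by blast
    define c where "c = norm (g y) + L * B"
    \<comment> \<open>A Lipschitz field grows at most linearly, and E \<ge> 1 absorbs the constant
      term \<open>norm (g y)\<close>. So the integral grows no faster than E, and \<open>P u\<close>
      is bounded.\<close>
    have "norm (h u s) \<le> c * exp (2 * L * s)" if "s \<ge> 0" for s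
    proof -
      have "norm (h u s) \<le> norm (g y) + norm (h u s - g y)"
        by (metis add.commute diff_add_cancel norm_triangle_ineq)
      also have "norm (h u s - g y) \<le> L * (E s * norm (apply_bcontfun u s))"
        using gL[of "y + E s *\<^sub>R apply_bcontfun u s" y] E[of s] by (simp add: h_def)
      also have "\<dots> \<le> L * (E s * B)"
        using L E[of s] B[of s] by (intro mult_left_mono) auto
      also have "norm (g y) \<le> norm (g y) * E s"
        using that L by (auto simp: E_def mult_le_cancel_left1)
      finally show ?thesis by (simp add: c_def E_def algebra_simps)
    qed
    moreover have "c \<ge> 0" using B0 L by (simp add: c_def)
    ultimately have I: "norm (integral {0..t} (h u)) \<le> c / (2 * L) * E t" if "t \<ge> 0" for t
      unfolding E_def using that L
      by (intro norm_integral_le_exp hcont) auto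
    have "norm (P u t) \<le> c / (2 * L)" for t
      using I[of "max 0 t"] E[of "max 0 t"] by (simp add: P_def field_simps)
    then show ?thesis by (auto simp: bounded_iff)
  qed
  define \<Phi> where "\<Phi> u = Bcontfun (P u)" for u
  have \<Phi>: "apply_bcontfun (\<Phi> u) = P u" for u
    unfolding \<Phi>_def by (rule Bcontfun_inverse) (auto simp: bcontfun_def Pcont Pbound)
  have contr: "dist (\<Phi> u) (\<Phi> v) \<le> 1/2 * dist u v" for u v
  proof (rule dist_bound)
    fix t :: real
    define T where "T = max 0 t"
    have T: "T \<ge> 0" by (simp add: T_def)
    have "norm (h u s - h v s) \<le> L * dist u v * exp (2 * L * s)" for s
    proof -
      have "norm (h u s - h v s) \<le> L * (E s * dist (apply_bcontfun u s) (apply_bcontfun v s))"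
        using gL[of "y + E s *\<^sub>R apply_bcontfun u s" "y + E s *\<^sub>R apply_bcontfun v s"] E[of s]
        by (simp add: h_def dist_norm flip: scaleR_diff_right)
      also have "\<dots> \<le> L * (E s * dist u v)"
        using L E[of s] dist_bounded[of u s v] by (intro mult_left_mono) auto
      finally show ?thesis by (simp add: E_def algebra_simps)
    qed
    then have "norm (integral {0..T} (\<lambda>s. h u s - h v s)) \<le> L * dist u v / (2 * L) * exp (2 * L * T)"
      using L T by (intro norm_integral_le_exp continuous_intros hcont) auto
    also have "integral {0..T} (\<lambda>s. h u s - h v s) = integral {0..T} (h u) - integral {0..T} (h v)"
      by (intro integral_diff integrable_continuous_real hcont)
    finally have "norm (integral {0..T} (h u) - integral {0..T} (h v)) \<le> 1/2 * dist u v * E T"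
      using L by (simp add: E_def)
    then show "dist (apply_bcontfun (\<Phi> u) t) (apply_bcontfun (\<Phi> v) t) \<le> 1/2 * dist u v"
      using E[of T]
      by (simp add: \<Phi> P_def dist_norm T_def[symmetric] pos_divide_le_eq flip: scaleR_diff_right)
  qed
  obtain u where u: "\<Phi> u = u"
    using banach_fix_type[of "1/2" \<Phi>] contr by auto
  define x where "x t = y + integral {0..t} (h u)" for t
  \<comment> \<open>Multiplied by \<open>E t\<close>, the fixed-point equation identifies the
    weighted u with the integral that defines x.\<close>
  have hx: "h u t = g (x t)" if "t \<ge> 0" for t
  proof -
    have "apply_bcontfun u t = (1 / E t) *\<^sub>R integral {0..t} (h u)"
      using arg_cong[OF u, of "\<lambda>f. apply_bcontfun f t"] that by (simp add: \<Phi> P_def)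
    then have "E t *\<^sub>R apply_bcontfun u t = integral {0..t} (h u)"
      using E[of t] by simp
    then show ?thesis unfolding x_def by (subst h_def) simp
  qed
  show ?thesis
  proof (rule that[of x])
    show "x 0 = y" by (simp add: x_def)
    fix t :: real assume "0 \<le> t"
    then show "(x has_vector_derivative g (x t)) (at t within {0..})"
      using hder[of t u] hx[of t] by (auto simp: x_def[abs_def] intro!: derivative_eq_intros)
  qed
qed

section \<open>Stability from a strict minimum of a first integral\<close>

text \<open>On reaching the sphere, H would still have its initial value below h, while
  \<open>barrier\<close> demands a value above h. The differential equation is assumed only while x
  is in the ball, so solutions of another field that agrees with f there are covered too.\<close>

lemma conserved_quantity_trapping:
  fixes x :: "real \<Rightarrow> 'a::real_normed_vector" and H :: "'a \<Rightarrow> real"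
  assumes cont: "continuous_on {0..T} x"
    and sol: "\<And>s. s \<in> {0..T} \<Longrightarrow> x s \<in> cball z0 \<rho> \<Longrightarrow>
                (x has_vector_derivative f (x s)) (at s within {0..T})"
    and H: "\<And>z. z \<in> cball z0 \<rho> \<Longrightarrow> (H has_derivative H' z) (at z)"
    and conserved: "\<And>z. z \<in> cball z0 \<rho> \<Longrightarrow> H' z (f z) = 0"
    and barrier: "\<And>z. z \<in> sphere z0 \<rho> \<Longrightarrow> h < H z"
    and start: "H (x 0) < h" "dist (x 0) z0 < \<rho>"
    and t: "t \<in> {0..T}"
  shows "dist (x t) z0 < \<rho>"
proof (rule ccontr)
  assume "\<not> dist (x t) z0 < \<rho>"
  define S where "S = {s \<in> {0..T}. \<rho> \<le> dist (x s) z0}"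
  have dcont: "continuous_on {0..T} (\<lambda>s. dist (x s) z0)"
    by (intro continuous_intros cont)
  have "closed S"
    unfolding S_def by (intro continuous_closed_preimage_constant continuous_on_closed_Collect_le dcont)
       (auto intro!: continuous_intros)
  then have "compact S"
    unfolding S_def compact_eq_bounded_closed
    by (auto intro: bounded_subset[OF bounded_closed_interval[of 0 T]])
  moreover have "t \<in> S" using t \<open>\<not> _\<close> by (auto simp: S_def)
  ultimately obtain s1 where s1: "s1 \<in> S" "\<And>s. s \<in> S \<Longrightarrow> s1 \<le> s"
    using compact_attains_inf[of S] by blast
  \<comment> \<open>s1 is the first time at distance at least \<rho>. The intermediate value theorem
    gives a time s \<le> s1 at distance exactly \<rho>, and minimality of s1 keeps the path in the
    closed ball up to s.\<close>
  obtain s where s: "0 \<le> s" "s \<le> s1" "dist (x s) z0 = \<rho>"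
    using IVT'[of "\<lambda>s. dist (x s) z0" 0 \<rho> s1] s1(1) start(2)
      continuous_on_subset[OF dcont, of "{0..s1}"]
    by (auto simp: S_def)
  have sT: "s \<le> T" using s s1(1) by (auto simp: S_def)
  have inside: "x r \<in> cball z0 \<rho>" if "r \<in> {0..s}" for r
    using that s s1(2)[of r] sT by (cases "r = s") (force simp: S_def dist_commute)+
  have "((\<lambda>r. H (x r)) has_derivative (\<lambda>_. 0)) (at r within {0..s})" if r: "r \<in> {0..s}" for r
  proof -
    have "(x has_derivative (\<lambda>d. d *\<^sub>R f (x r))) (at r within {0..s})"
      using sol[of r] inside[OF r] r sT
      by (auto simp: has_vector_derivative_def intro: has_derivative_subset)
    from has_derivative_compose[OF this H[OF inside[OF r]]]
    have "((\<lambda>r. H (x r)) has_derivative (\<lambda>d. H' (x r) (d *\<^sub>R f (x r)))) (at r within {0..s})" .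
    also have "(\<lambda>d. H' (x r) (d *\<^sub>R f (x r))) = (\<lambda>_. 0)"
      using conserved[OF inside[OF r]] linear_scale[OF has_derivative_linear[OF H[OF inside[OF r]]]]
      by auto
    finally show ?thesis .
  qed
  then obtain c where "\<And>r. r \<in> {0..s} \<Longrightarrow> H (x r) = c"
    using has_derivative_zero_constant[of "{0..s}" "\<lambda>r. H (x r)"] by auto
  then have "H (x 0) = H (x s)" using s by simp
  moreover have "h < H (x s)"
    using s by (intro barrier) (auto simp: dist_commute)
  ultimately show False using start by simp
qed

text \<open>Lagrange-Dirichlet: a level h strictly between \<open>H z0\<close> and the minimum of H
  on a small sphere traps every path that starts close to z0. Stability here includes the existence
  of solutions for all t \<ge> 0; the Lipschitz bound serves to construct them.\<close>

lemma lyapunov_stable_if_strict_min_conserved: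
  assumes r: "r > 0" "cball z0 r \<subseteq> D" and eq: "f z0 = 0"
    and lip: "L-lipschitz_on (cball z0 r) f"
    and H: "\<And>z. z \<in> cball z0 r \<Longrightarrow> (H has_derivative H' z) (at z)"
    and conserved: "\<And>z. z \<in> cball z0 r \<Longrightarrow> H' z (f z) = (0::real)"
    and strict_min: "\<And>z. z \<in> cball z0 r \<Longrightarrow> z \<noteq> z0 \<Longrightarrow> H z0 < H z"
  shows "lyapunov_stable f D z0"
  unfolding lyapunov_stable_def
proof (intro conjI allI impI)
  show "z0 \<in> D" using r by auto
  show "f z0 = 0" by (rule eq)
  fix \<epsilon> :: real assume \<epsilon>: "\<epsilon> > 0"
  define \<rho> where "\<rho> = min r \<epsilon>"
  have \<rho>: "\<rho> > 0" "\<rho> \<le> r" "\<rho> \<le> \<epsilon>" using r \<epsilon> by (auto simp: \<rho>_def)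
  have sub: "cball z0 \<rho> \<subseteq> cball z0 r" using \<rho> by auto
  have Hcont: "continuous_on (cball z0 r) H"
    using H by (meson continuous_at_imp_continuous_on has_derivative_continuous)
  obtain h where h: "H z0 < h" "\<And>z. z \<in> sphere z0 \<rho> \<Longrightarrow> h < H z"
  \<comment> \<open>The minimum is attained only on a nonempty sphere; otherwise any h above
    \<open>H z0\<close> serves.\<close>
  proof (cases "sphere z0 \<rho> = {}")
    case True
    then show ?thesis using that[of "H z0 + 1"] by auto
  next
    case False
    have "sphere z0 \<rho> \<subseteq> cball z0 r" using sub by (auto simp: sphere_def)
    then obtain w where w: "w \<in> sphere z0 \<rho>" "\<And>z. z \<in> sphere z0 \<rho> \<Longrightarrow> H w \<le> H z"
      using continuous_attains_inf[of "sphere z0 \<rho>" H] False continuous_on_subset[OF Hcont]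
      by auto
    have "H z0 < H w" using w(1) \<rho> by (intro strict_min) (auto simp: sphere_def)
    then show ?thesis
      by (intro that[of "(H z0 + H w) / 2"]) (use w(2) in force)+
  qed
  have "isCont H z0" using H[of z0] r by (auto intro: has_derivative_continuous)
  then have "\<forall>\<^sub>F z in nhds z0. H z < h"
    using h(1) by (metis isCont_def order_tendstoD(2) eventually_nhds_conv_at)
  then obtain d where d: "d > 0" "\<And>z. dist z z0 < d \<Longrightarrow> H z < h"
    unfolding eventually_nhds_metric by auto
  define \<delta> where "\<delta> = min d \<rho>"
  \<comment> \<open>One statement for two uses: arbitrary solutions of f, and the solution of the
    retracted field, of which it is not yet known that it stays in D.\<close>
  have trapped: "dist (x t) z0 < \<rho>"
    if "dist (x 0) z0 < \<delta>" "t \<in> {0..T}" "continuous_on {0..T} x"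
      "\<And>s. s \<in> {0..T} \<Longrightarrow> x s \<in> cball z0 \<rho> \<Longrightarrow>
         (x has_vector_derivative f (x s)) (at s within {0..T})" for x T t
    using that h(2) d(2)[of "x 0"] H conserved sub
    by (intro conserved_quantity_trapping[of T x z0 \<rho> f H H' h t]) (auto simp: \<delta>_def)
  show "\<exists>\<delta>>0. \<forall>y\<in>D. dist y z0 < \<delta> \<longrightarrow> (\<exists>x. is_solution f D {0..} x \<and> x 0 = y) \<and>
      (\<forall>T x. is_solution f D {0..T} x \<longrightarrow> x 0 = y \<longrightarrow> (\<forall>t\<in>{0..T}. dist (x t) z0 < \<epsilon>))"
  proof (intro exI[of _ \<delta>] conjI ballI impI allI)
    show "\<delta> > 0" using d \<rho> by (auto simp: \<delta>_def)
  next
    fix y T x t assume y: "dist y z0 < \<delta>" and x: "is_solution f D {0..T} x" "x 0 = y"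
      and t: "t \<in> {0..T}"
    have "continuous_on {0..T} x"
      using x(1) unfolding is_solution_def
      by (meson continuous_on_eq_continuous_within has_vector_derivative_continuous)
    then have "dist (x t) z0 < \<rho>"
      using x y t by (intro trapped[of x t T]) (auto simp: is_solution_def)
    then show "dist (x t) z0 < \<epsilon>" using \<rho> by simp
  next
    fix y assume y: "dist y z0 < \<delta>"
    \<comment> \<open>Retracting onto the ball makes the field globally Lipschitz; by trapping, the retraction
      is never felt.\<close>
    define g where "g = f \<circ> closest_point (cball z0 \<rho>)"
    have cp: "closest_point (cball z0 \<rho>) z \<in> cball z0 r" for z
      using closest_point_in_set[of "cball z0 \<rho>" z] \<rho> sub by fastforce
    have "(L * 1)-lipschitz_on UNIV g"
      unfolding g_def
    proof (rule lipschitz_on_compose)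
      show "1-lipschitz_on UNIV (closest_point (cball z0 \<rho>))"
        using \<rho> by (intro lipschitz_onI) (auto intro!: closest_point_lipschitz)
      show "L-lipschitz_on (range (closest_point (cball z0 \<rho>))) f"
        using cp by (intro lipschitz_on_subset[OF lip]) auto
    qed
    then obtain x where x: "x 0 = y"
      "\<And>t. 0 \<le> t \<Longrightarrow> (x has_vector_derivative g (x t)) (at t within {0..})"
      using lipschitz_ode_global_solution by metis
    have gf: "g z = f z" if "z \<in> cball z0 \<rho>" for z
      using that by (simp add: g_def closest_point_self)
    have in_ball: "dist (x t) z0 < \<rho>" if "t \<ge> 0" for t
    proof (rule trapped[of x t t])
      have xt: "(x has_vector_derivative g (x s)) (at s within {0..t})" if "s \<in> {0..t}" for s
        using x(2)[of s] that by (auto intro: has_vector_derivative_within_subset)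
      then show "continuous_on {0..t} x"
        by (meson continuous_on_eq_continuous_within has_vector_derivative_continuous)
      show "(x has_vector_derivative f (x s)) (at s within {0..t})"
        if "s \<in> {0..t}" "x s \<in> cball z0 \<rho>" for s
        using xt that gf by metis
    qed (use that x y in auto)
    have "is_solution f D {0..} x"
      unfolding is_solution_def
    proof (intro ballI conjI)
      fix t :: real assume "t \<in> {0..}"
      then have b: "x t \<in> cball z0 \<rho>"
        using in_ball[of t] by (auto simp: dist_commute)
      show "x t \<in> D" using b sub r by blast
      show "(x has_vector_derivative f (x t)) (at t within {0..})"
        using x(2)[of t] gf[OF b] \<open>t \<in> {0..}\<close> by simp
    qed
    then show "\<exists>x. is_solution f D {0..} x \<and> x 0 = y" using x by blast
  qed
qed

section \<open>The potential on the equator\<close>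

lemma cot_eq_iff:
  fixes a b :: real
  assumes "0 < a" "a < pi" "0 < b" "b < pi"
  shows "cot a = cot b \<longleftrightarrow> a = b"
proof
  assume "cot a = cot b"
  then have "sin (a - b) = 0"
    using sin_gt_zero[of a] sin_gt_zero[of b] assms by (simp add: cot_def sin_diff field_simps)
  then show "a = b" using sin_zero_pi_iff[of "a - b"] assms by auto
qed simp

lemma cot_add_cot:
  fixes a b :: real
  assumes "sin a \<noteq> 0" "sin b \<noteq> 0"
  shows "cot a + cot b = sin (a + b) / (sin a * sin b)"
  using assms by (simp add: cot_def sin_add field_simps)

text \<open>The weights are those that the fixed-point equations force on the products of masses.
  Since \<open>cot (a + b) = (x * y - 1) / (x + y)\<close>, the function is rational in the
  cotangents x and y. Multiplying by s clears the denominator and, s being negative, reverses the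
  inequality.\<close>

lemma cot_sum_strict_max:
  fixes a b \<alpha> \<beta> :: real
  assumes "0 < \<alpha>" "\<alpha> < pi" "0 < \<beta>" "\<beta> < pi" "pi < \<alpha> + \<beta>" "\<alpha> + \<beta> < 2 * pi"
    and "0 < a" "a < pi" "0 < b" "b < pi" "pi < a + b" "a + b < 2 * pi"
    and neq: "(a, b) \<noteq> (\<alpha>, \<beta>)"
  shows "(sin \<alpha>)\<^sup>2 * cot a + (sin \<beta>)\<^sup>2 * cot b - (sin (\<alpha> + \<beta>))\<^sup>2 * cot (a + b)
       < (sin \<alpha>)\<^sup>2 * cot \<alpha> + (sin \<beta>)\<^sup>2 * cot \<beta> - (sin (\<alpha> + \<beta>))\<^sup>2 * cot (\<alpha> + \<beta>)"
    (is "?F a b < ?F \<alpha> \<beta>")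
proof -
  define x y x0 y0 where xy: "x = cot a" "y = cot b" "x0 = cot \<alpha>" "y0 = cot \<beta>"
  define s s0 where s: "s = x + y" "s0 = x0 + y0"
  define p q where pq: "p = (sin \<alpha>)\<^sup>2" "q = (sin \<beta>)\<^sup>2"
  \<comment> \<open>Stated for a generic pair because it is applied at (\<alpha>, \<beta>) and at
    (a, b). The angle sum lies beyond \<pi>, so its sine, and with it the sum of the cotangents, is
    negative.\<close>
  have sgn: "sin c > 0 \<and> sin d > 0 \<and> cot c + cot d < 0 \<and>
      cot (c + d) * (cot c + cot d) = cot c * cot d - 1"
    if "0 < c" "c < pi" "0 < d" "d < pi" "pi < c + d" "c + d < 2 * pi" for c d
  proof -
    have *: "sin c > 0" "sin d > 0" "sin (c + d) < 0"
      using that sin_gt_zero sin_lt_zero by auto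
    then have "cot (c + d) * (cot c + cot d) = cos (c + d) / (sin c * sin d)"
      by (simp add: cot_add_cot) (simp add: cot_def)
    also have "\<dots> = cot c * cot d - 1"
      using * by (simp add: cot_def cos_add field_simps)
    finally show ?thesis using * by (simp add: cot_add_cot divide_neg_pos)
  qed
  note A = sgn[of \<alpha> \<beta>] and B = sgn[of a b]
  have sneg: "s < 0" "s0 < 0" using A B assms by (auto simp: xy s)
  have p: "p > 0" "p * (1 + x0\<^sup>2) = 1" and q: "q > 0" "q * (1 + y0\<^sup>2) = 1"
    using A assms sin_cos_squared_add[of \<alpha>] sin_cos_squared_add[of \<beta>]
    by (auto simp: pq xy cot_def field_simps)
  \<comment> \<open>By the addition formula s0 is the sine of the sum divided by the product of the
    sines; now all three weights are expressed through x0 and y0.\<close>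
  have pq_sin: "(sin (\<alpha> + \<beta>))\<^sup>2 = s0\<^sup>2 * p * q"
    using A assms cot_add_cot[of \<alpha> \<beta>] by (simp add: pq xy s power_divide power_mult_distrib)
  have F: "s * ?F a b = p * q * (s * ((1 + y0\<^sup>2) * x + (1 + x0\<^sup>2) * y) - s0\<^sup>2 * (x * y - 1))"
  proof -
    have "s * ?F a b = s * (p * x + q * y) - s0\<^sup>2 * p * q * (cot (a + b) * s)"
      by (simp add: pq_sin pq[symmetric] xy(1,2)[symmetric] algebra_simps)
    also have "cot (a + b) * s = x * y - 1" using B assms by (simp add: xy s)
    \<comment> \<open>Inserting factors equal to 1 brings out the common factor p * q.\<close>
    also have "p * x + q * y = p * (q * (1 + y0\<^sup>2)) * x + q * (p * (1 + x0\<^sup>2)) * y"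
      using p q by simp
    finally show ?thesis by (simp add: algebra_simps)
  qed
  have F0: "?F \<alpha> \<beta> = p * q * (2 * s0)"
  proof -
    have "?F \<alpha> \<beta> = p * x0 + q * y0 - s0 * p * q * (cot (\<alpha> + \<beta>) * s0)"
      by (simp add: pq_sin pq[symmetric] xy(3,4)[symmetric]) (simp add: power2_eq_square)
    also have "cot (\<alpha> + \<beta>) * s0 = x0 * y0 - 1" using A assms by (simp add: xy s)
    also have "p * x0 + q * y0 = p * (q * (1 + y0\<^sup>2)) * x0 + q * (p * (1 + x0\<^sup>2)) * y0"
      using p q by simp
    finally show ?thesis by (simp add: s algebra_simps power2_eq_square)
  qed
  \<comment> \<open>Up to the factor p * q the left side is (s - s0)^2 plus the quadratic form (x +
    y) (y0^2 x + x0^2 y) - s0^2 x y, and this form is the square of y0 x - x0 y.\<close>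
  have key: "s * (?F a b - ?F \<alpha> \<beta>) = p * q * ((s - s0)\<^sup>2 + (y0 * x - x0 * y)\<^sup>2)"
    unfolding right_diff_distrib[of s "?F a b"] F F0 by (simp add: s algebra_simps power2_eq_square)
  have "\<not> (s - s0 = 0 \<and> y0 * x - x0 * y = 0)"
  proof
    assume *: "s - s0 = 0 \<and> y0 * x - x0 * y = 0"
    \<comment> \<open>If both squares vanish, x - x0 and y - y0 solve a homogeneous linear system
      with determinant -s0, which is nonzero; this identity eliminates y.\<close>
    have "s0 * (x - x0) = (y0 * x - x0 * y) + x0 * (s - s0)" by (simp add: s algebra_simps)
    then have "x = x0" using * sneg by simp
    moreover from this have "y = y0" using * by (simp add: s)
    ultimately show False using neq assms by (simp add: xy cot_eq_iff)
  qed
  then have "(s - s0)\<^sup>2 + (y0 * x - x0 * y)\<^sup>2 > 0"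
    by (simp add: sum_power2_gt_zero_iff)
  then have "s * (?F a b - ?F \<alpha> \<beta>) > 0" using key p(1) q(1) by simp
  then show ?thesis using sneg by (simp add: zero_less_mult_iff)
qed

section \<open>Equatorial configurations and the fixed-point equations\<close>

lemma geod_dist_equator_pt: "geod_dist (equator_pt a) (equator_pt b) = arccos (cos (b - a))"
  by (simp add: geod_dist_def equator_pt_def inner_prod_def cos_diff mult.commute)

text \<open>The third longitude lies beyond \<pi>, so the geodesic distance between the first and
  third masses is 2 \<pi> - (a + b); its cotangent is the source of the minus sign.\<close>

lemma acute_equatorial_config:
  assumes "0 < a" "a < pi" "0 < b" "b < pi" "pi < a + b" "a + b < 2 * pi"
  shows "(equator_pt 0, equator_pt a, equator_pt (a + b)) \<in> config_space"
    and "force_fun m1 m2 m3 (equator_pt 0, equator_pt a, equator_pt (a + b))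
          = m1 * m2 * cot a + m2 * m3 * cot b - m1 * m3 * cot (a + b)"
proof -
  have n: "norm (equator_pt t) = 1" for t
    by (simp add: equator_pt_def norm_prod_def)
  have "cos (a + b) = cos (2 * pi - (a + b))"
    by (simp only: cos_diff) simp
  then have "arccos (cos (a + b)) = 2 * pi - (a + b)"
    using assms by (simp only: arccos_cos)
  then have d: "geod_dist (equator_pt 0) (equator_pt a) = a"
    "geod_dist (equator_pt a) (equator_pt (a + b)) = b"
    "geod_dist (equator_pt 0) (equator_pt (a + b)) = 2 * pi - (a + b)"
    using assms by (simp_all add: geod_dist_equator_pt arccos_cos)
  show "(equator_pt 0, equator_pt a, equator_pt (a + b)) \<in> config_space"
    using assms d n by (auto simp: config_space_def)
  have "cot (2 * pi - (a + b)) = - cot (a + b)"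
    by (simp add: cot_def sin_diff cos_diff)
  then show "force_fun m1 m2 m3 (equator_pt 0, equator_pt a, equator_pt (a + b))
      = m1 * m2 * cot a + m2 * m3 * cot b - m1 * m3 * cot (a + b)"
    using d by (simp add: force_fun_def)
qed

lemma has_real_derivative_cot:
  fixes g :: "real \<Rightarrow> real"
  assumes "(g has_real_derivative D) (at x)" "sin (g x) \<noteq> 0"
  shows "((\<lambda>x. cot (g x)) has_real_derivative - inverse ((sin (g x))\<^sup>2) * D) (at x)"
  using DERIV_chain2[OF DERIV_cot assms(1)] assms(2) by simp

lemma has_derivative_cot:
  fixes g :: "'a::real_normed_vector \<Rightarrow> real"
  assumes "(g has_derivative g') (at x)" "sin (g x) \<noteq> 0"
  shows "((\<lambda>x. cot (g x)) has_derivative (\<lambda>v. g' v * - inverse ((sin (g x))\<^sup>2))) (at x)"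
  using DERIV_compose_FDERIV[OF DERIV_cot assms(1)] assms(2) by simp

text \<open>Criticality is tested along the curve that moves the masses on the equator with angular
  speeds 0, u and u + v. The left side is minus the derivative of the force function along
  it.\<close>

lemma fixed_point_equatorial_variation:
  fixes u v :: real
  assumes ab: "0 < \<alpha>" "\<alpha> < pi" "0 < \<beta>" "\<beta> < pi" "pi < \<alpha> + \<beta>" "\<alpha> + \<beta> < 2 * pi"
    and fp: "fixed_point m1 m2 m3 (equator_pt 0, equator_pt \<alpha>, equator_pt (\<alpha> + \<beta>))"
  shows "m1 * m2 / (sin \<alpha>)\<^sup>2 * u + m2 * m3 / (sin \<beta>)\<^sup>2 * v
          - m1 * m3 / (sin (\<alpha> + \<beta>))\<^sup>2 * (u + v) = 0"
proof -
  define A B where AB: "A t = \<alpha> + u * t" "B t = \<beta> + v * t" for t :: real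
  \<comment> \<open>For these parameters the configuration is still acute and the cotangent formula
    for the force function holds. S is open, so it contains an interval around 0.\<close>
  define S where "S = {t. 0 < A t \<and> A t < pi \<and> 0 < B t \<and> B t < pi \<and> pi < A t + B t \<and> A t + B t < 2 * pi}"
  have "open S"
    unfolding S_def AB by (intro open_Collect_conj open_Collect_less continuous_intros)
  moreover have "0 \<in> S" using ab by (simp add: S_def AB)
  ultimately obtain e where e: "e > 0" "ball 0 e \<subseteq> S"
    by (meson open_contains_ball)
  define \<gamma> where "\<gamma> t = (equator_pt 0, equator_pt (A t), equator_pt (A t + B t))" for t
  have inS: "t \<in> S" if "t \<in> {-e<..<e}" for t
    using e that by (auto simp: dist_real_def subset_iff)
  have "\<gamma> t \<in> config_space" if "t \<in> {-e<..<e}" for t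
    unfolding \<gamma>_def using inS[OF that] by (intro acute_equatorial_config(1)) (auto simp: S_def)
  moreover have "\<gamma> 0 = (equator_pt 0, equator_pt \<alpha>, equator_pt (\<alpha> + \<beta>))"
    by (simp add: \<gamma>_def AB)
  moreover have "\<gamma> differentiable (at 0)"
    unfolding \<gamma>_def equator_pt_def AB differentiable_def
    by (rule exI) (auto intro!: derivative_eq_intros)
  ultimately have "((force_fun m1 m2 m3 \<circ> \<gamma>) has_real_derivative 0) (at 0)"
    using fp e unfolding fixed_point_def by blast
  moreover have "(force_fun m1 m2 m3 \<circ> \<gamma>) t
      = m1 * m2 * cot (A t) + m2 * m3 * cot (B t) - m1 * m3 * cot (A t + B t)"
    if "t \<in> ball 0 e" for t
    using e that acute_equatorial_config(2)[of "A t" "B t" m1 m2 m3] by (auto simp: \<gamma>_def S_def)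
  ultimately have D0: "((\<lambda>t. m1 * m2 * cot (A t) + m2 * m3 * cot (B t) - m1 * m3 * cot (A t + B t))
      has_real_derivative 0) (at 0)"
    using has_field_derivative_transform_within_open[of _ 0 0 "ball 0 e"] e(1) by fastforce
  have sn: "sin (A 0) \<noteq> 0" "sin (B 0) \<noteq> 0" "sin (A 0 + B 0) \<noteq> 0"
    using ab sin_gt_zero[of \<alpha>] sin_gt_zero[of \<beta>] sin_lt_zero[of "\<alpha> + \<beta>"] by (auto simp: AB)
  have dA: "(A has_real_derivative u) (at 0)" "(B has_real_derivative v) (at 0)"
    unfolding AB[abs_def] by (auto intro!: derivative_eq_intros)
  have "((\<lambda>t. m1 * m2 * cot (A t) + m2 * m3 * cot (B t) - m1 * m3 * cot (A t + B t))
      has_real_derivative (m1 * m2 * (- inverse ((sin (A 0))\<^sup>2) * u)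
        + m2 * m3 * (- inverse ((sin (B 0))\<^sup>2) * v)
        - m1 * m3 * (- inverse ((sin (A 0 + B 0))\<^sup>2) * (u + v)))) (at 0)"
    by (intro DERIV_diff DERIV_add DERIV_cmult has_real_derivative_cot dA sn)
  from DERIV_unique[OF this D0] show ?thesis
    by (simp add: AB divide_inverse algebra_simps)
qed

text \<open>The variations (1, 0) and (0, 1) make the three quotients of mass product by squared
  sine equal; k is their common value.\<close>

lemma fixed_point_equatorial_masses:
  assumes "m1 > 0" "m3 > 0"
    and ab: "0 < \<alpha>" "\<alpha> < pi" "0 < \<beta>" "\<beta> < pi" "pi < \<alpha> + \<beta>" "\<alpha> + \<beta> < 2 * pi"
    and fp: "fixed_point m1 m2 m3 (equator_pt 0, equator_pt \<alpha>, equator_pt (\<alpha> + \<beta>))"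
  obtains k where "k > 0" "m1 * m2 = k * (sin \<alpha>)\<^sup>2" "m2 * m3 = k * (sin \<beta>)\<^sup>2"
    "m1 * m3 = k * (sin (\<alpha> + \<beta>))\<^sup>2"
proof -
  have sn: "sin \<alpha> \<noteq> 0" "sin \<beta> \<noteq> 0" "sin (\<alpha> + \<beta>) \<noteq> 0"
    using ab sin_gt_zero[of \<alpha>] sin_gt_zero[of \<beta>] sin_lt_zero[of "\<alpha> + \<beta>"] by auto
  define k where "k = m1 * m3 / (sin (\<alpha> + \<beta>))\<^sup>2"
  have "m1 * m2 / (sin \<alpha>)\<^sup>2 = k" "m2 * m3 / (sin \<beta>)\<^sup>2 = k"
    using fixed_point_equatorial_variation[OF ab fp, of 1 0]
      fixed_point_equatorial_variation[OF ab fp, of 0 1] by (simp_all add: k_def)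
  moreover have "k > 0" using assms sn by (simp add: k_def)
  ultimately show ?thesis
    using sn by (intro that[of k]) (auto simp: nonzero_divide_eq_eq, simp add: k_def)
qed

section \<open>The reduced Hamiltonian system\<close>

text \<open>\<open>ham_field\<close> is built from \<open>deriv\<close>, which is evaluated here
  where the potential is differentiable. The result is linear in the momenta and in three inverse
  squared sines.\<close>

lemma ham_field_H_red:
  assumes "(q1, q2, p1, p2) \<in> red_domain m1 m2"
  defines "a \<equiv> inverse ((sin q1)\<^sup>2)" and "b \<equiv> inverse ((sin (q2 - nu1 m1 m2 * q1))\<^sup>2)"
    and "c \<equiv> inverse ((sin (q2 + nu2 m1 m2 * q1))\<^sup>2)"
  shows "ham_field (H_red m1 m2 m3 \<omega>) (q1, q2, p1, p2) =
    (p1 / nu3 m1 m2, p2 / nu4 m1 m2 m3,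
     m2 * m3 * nu1 m1 m2 * b + m1 * m3 * nu2 m1 m2 * c - m1 * m2 * a,
     m1 * m3 * c - m2 * m3 * b)"
proof -
  have sn: "sin q1 \<noteq> 0" "sin (q2 - nu1 m1 m2 * q1) \<noteq> 0" "sin (q2 + nu2 m1 m2 * q1) \<noteq> 0"
    using assms(1) by (auto simp: red_domain_def)
  \<comment> \<open>The momentum components of the field are negated derivatives; \<open>neg\<close>
    moves the sign into the value of the derivative.\<close>
  have neg: "- deriv f x = d" if "(f has_real_derivative - d) (at x)" for f and x d :: real
    using DERIV_imp_deriv[OF that] by simp
  show ?thesis
    unfolding ham_field_def H_red_def V_red_def prod.case prod.inject a_def b_def c_def divide_inverse
    by (intro conjI DERIV_imp_deriv neg)
      (use sn in \<open>auto intro!: derivative_eq_intros has_real_derivative_cot simp: algebra_simps\<close>)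
qed

section \<open>Local Lipschitz continuity of the Hamiltonian field\<close>

text \<open>On a closed ball free of zeros of the sine the derivative is bounded by compactness, and
  the mean value inequality applies.\<close>

lemma inverse_sin_squared_locally_lipschitz:
  fixes c :: real
  assumes "sin c \<noteq> 0"
  obtains r L where "r > 0" "L-lipschitz_on (cball c r) (\<lambda>s. inverse ((sin s)\<^sup>2))"
proof -
  have "open {s::real. sin s \<noteq> 0}" by (intro open_Collect_neq continuous_intros)
  then obtain r where r: "r > 0" "cball c r \<subseteq> {s. sin s \<noteq> 0}"
    using assms open_contains_cball by blast
  define D where "D s = - 2 * cos s / (sin s)^3" for s :: real
  have "continuous_on (cball c r) D"
    unfolding D_def using r by (intro continuous_intros) auto
  then have "bounded (D ` cball c r)"
    by (intro compact_imp_bounded compact_continuous_image) auto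
  then obtain B where B: "\<And>s. s \<in> cball c r \<Longrightarrow> norm (D s) \<le> B"
    unfolding bounded_iff by blast
  have "B \<ge> 0" using B[of c] r by (auto intro: order_trans[OF norm_ge_zero])
  have "B-lipschitz_on (cball c r) (\<lambda>s. inverse ((sin s)\<^sup>2))"
  proof (rule lipschitz_onI[OF _ \<open>B \<ge> 0\<close>])
    fix s t assume st: "s \<in> cball c r" "t \<in> cball c r"
    have "norm (inverse ((sin s)\<^sup>2) - inverse ((sin t)\<^sup>2)) \<le> B * norm (s - t)"
    proof (rule field_differentiable_bound[of "cball c r" _ D])
      fix z assume z: "z \<in> cball c r"
      then have "sin z \<noteq> 0" using r by auto
      then show "((\<lambda>s. inverse ((sin s)\<^sup>2)) has_field_derivative D z) (at z within cball c r)"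
        by (auto intro!: derivative_eq_intros simp: D_def field_simps power2_eq_square power3_eq_cube)
    qed (use B st in auto)
    then show "dist (inverse ((sin s)\<^sup>2)) (inverse ((sin t)\<^sup>2)) \<le> B * dist s t"
      by (simp add: dist_norm)
  qed
  then show ?thesis using that r by blast
qed

lemma inverse_sin_squared_comp_locally_lipschitz:
  fixes l :: "'a::real_normed_vector \<Rightarrow> real"
  assumes l: "bounded_linear l" and "sin (l z0) \<noteq> 0"
  obtains r L where "r > 0" "L-lipschitz_on (cball z0 r) (\<lambda>z. inverse ((sin (l z))\<^sup>2))"
proof -
  obtain r L where r: "r > 0" "L-lipschitz_on (cball (l z0) r) (\<lambda>s. inverse ((sin s)\<^sup>2))"
    using inverse_sin_squared_locally_lipschitz assms(2) by blast
  obtain K where K: "K > 0" "\<And>z. norm (l z) \<le> norm z * K"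
    using bounded_linear.pos_bounded[OF l] by auto
  have dK: "dist (l z) (l w) \<le> K * dist z w" for z w
    using K(2)[of "z - w"] bounded_linear.linear[OF l] by (simp add: dist_norm linear_diff mult.commute)
  have "(L * K)-lipschitz_on (cball z0 (r / K)) (\<lambda>z. inverse ((sin (l z))\<^sup>2))"
  proof (rule lipschitz_on_compose2[where f = l])
    show "K-lipschitz_on (cball z0 (r / K)) l"
      using dK K by (intro lipschitz_onI) auto
    have "l ` cball z0 (r / K) \<subseteq> cball (l z0) r"
    proof safe
      fix z assume "z \<in> cball z0 (r / K)"
      then show "l z \<in> cball (l z0) r"
        using dK[of z0 z] K by (simp add: field_simps)
    qed
    then show "L-lipschitz_on (l ` cball z0 (r / K)) (\<lambda>s. inverse ((sin s)\<^sup>2))"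
      using r by (auto intro: lipschitz_on_subset)
  qed
  then show ?thesis using that[of "r / K"] r K by auto
qed

text \<open>The three cotangent arguments are linear in the state, so on a common small ball the
  field is a linear combination of Lipschitz functions.\<close>

lemma ham_field_H_red_locally_lipschitz:
  assumes "z0 \<in> red_domain m1 m2"
  obtains r L where "r > 0" "cball z0 r \<subseteq> red_domain m1 m2"
    "L-lipschitz_on (cball z0 r) (ham_field (H_red m1 m2 m3 \<omega>))"
proof -
  define n1 n2 where n: "n1 = nu1 m1 m2" "n2 = nu2 m1 m2"
  define A B C :: "state \<Rightarrow> real" where ABC: "A z = fst z" "B z = fst (snd z) - n1 * fst z"
    "C z = fst (snd z) + n2 * fst z" for z
  define ia ib ic where i: "ia z = inverse ((sin (A z))\<^sup>2)" "ib z = inverse ((sin (B z))\<^sup>2)"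
    "ic z = inverse ((sin (C z))\<^sup>2)" for z
  have dom: "red_domain m1 m2 = {z. sin (A z) \<noteq> 0 \<and> sin (B z) \<noteq> 0 \<and> sin (C z) \<noteq> 0}"
    by (auto simp: red_domain_def ABC n)
  have "open (red_domain m1 m2)"
    unfolding dom ABC by (intro open_Collect_conj open_Collect_neq continuous_intros)
  then obtain r0 where r0: "r0 > 0" "cball z0 r0 \<subseteq> red_domain m1 m2"
    using assms open_contains_cball by blast
  have bl: "bounded_linear A" "bounded_linear B" "bounded_linear C"
    unfolding ABC[abs_def]
    by (intro bounded_linear_intros bounded_linear_fst_comp bounded_linear_snd_comp
      bounded_linear_const_mult bounded_linear_fst bounded_linear_snd)+
  have sn: "sin (A z0) \<noteq> 0" "sin (B z0) \<noteq> 0" "sin (C z0) \<noteq> 0"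
    using assms by (auto simp: dom)
  obtain r1 L1 where r1: "r1 > 0" "L1-lipschitz_on (cball z0 r1) ia"
    using inverse_sin_squared_comp_locally_lipschitz[OF bl(1) sn(1)] unfolding i[abs_def] by blast
  obtain r2 L2 where r2: "r2 > 0" "L2-lipschitz_on (cball z0 r2) ib"
    using inverse_sin_squared_comp_locally_lipschitz[OF bl(2) sn(2)] unfolding i[abs_def] by blast
  obtain r3 L3 where r3: "r3 > 0" "L3-lipschitz_on (cball z0 r3) ic"
    using inverse_sin_squared_comp_locally_lipschitz[OF bl(3) sn(3)] unfolding i[abs_def] by blast
  define r where "r = Min {r0, r1, r2, r3}"
  have r: "r > 0" "r \<le> r0" "r \<le> r1" "r \<le> r2" "r \<le> r3"
    using r0 r1 r2 r3 by (auto simp: r_def)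
  define U where "U = cball z0 r"
  have abc: "L1-lipschitz_on U ia" "L2-lipschitz_on U ib" "L3-lipschitz_on U ic"
    using r by (auto simp: U_def intro: lipschitz_on_subset[OF r1(2)]
      lipschitz_on_subset[OF r2(2)] lipschitz_on_subset[OF r3(2)])
  have p: "1-lipschitz_on U (\<lambda>z. fst (snd (snd z)))" "1-lipschitz_on U (\<lambda>z. snd (snd (snd z)))"
    by (intro lipschitz_onI; simp; meson dist_fst_le dist_snd_le order_trans)+
  define F where "F z = ((1 / nu3 m1 m2) * fst (snd (snd z)), (1 / nu4 m1 m2 m3) * snd (snd (snd z)),
     m2 * m3 * n1 * ib z + m1 * m3 * n2 * ic z - m1 * m2 * ia z,
     m1 * m3 * ic z - m2 * m3 * ib z)" for z :: state
  \<comment> \<open>\<open>exI\<close> leaves the constant schematic; the composition rules assemble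
    it.\<close>
  have "\<exists>L. L-lipschitz_on U F"
    unfolding F_def
    by (rule exI) (rule lipschitz_on_Pair lipschitz_on_diff lipschitz_on_add
        lipschitz_on_cmult_real abc p)+
  then obtain L where L: "L-lipschitz_on U F" by blast
  have Ud: "U \<subseteq> red_domain m1 m2"
    using r(2) r0(2) by (auto simp: U_def)
  have "ham_field (H_red m1 m2 m3 \<omega>) z = F z" if "z \<in> U" for z
    using ham_field_H_red[of "fst z" "fst (snd z)" "fst (snd (snd z))" "snd (snd (snd z))" m1 m2 m3 \<omega>]
      that Ud by (auto simp: F_def i ABC n)
  then have "L-lipschitz_on U (ham_field (H_red m1 m2 m3 \<omega>))"
    using lipschitz_on_transform[OF L] by metis
  then show ?thesis using that r(1) Ud unfolding U_def by blast
qed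

text \<open>Conservation of energy: with Hamilton's equations inserted into the differential of H,
  the products of conjugate partial derivatives cancel in pairs.\<close>

lemma H_red_derivative_along_ham_field:
  assumes "z \<in> red_domain m1 m2"
  obtains H' where "(H_red m1 m2 m3 \<omega> has_derivative H') (at z)"
    "H' (ham_field (H_red m1 m2 m3 \<omega>) z) = 0"
proof -
  obtain q1 q2 p1 p2 where z: "z = (q1, q2, p1, p2)" by (cases z)
  define n1 n2 where n: "n1 = nu1 m1 m2" "n2 = nu2 m1 m2"
  define a b c where abc: "a = inverse ((sin q1)\<^sup>2)" "b = inverse ((sin (q2 - n1 * q1))\<^sup>2)"
    "c = inverse ((sin (q2 + n2 * q1))\<^sup>2)"
  define H' where "H' v = (case v of (x1, x2, y1, y2) \<Rightarrow>
     p1 * y1 * inverse (nu3 m1 m2) + p2 * y2 * inverse (nu4 m1 m2 m3)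
     + m1 * m2 * a * x1 + m2 * m3 * b * (x2 - n1 * x1) - m1 * m3 * c * (x2 + n2 * x1))" for v :: state
  have sn: "sin q1 \<noteq> 0" "sin (q2 - n1 * q1) \<noteq> 0" "sin (q2 + n2 * q1) \<noteq> 0"
    using assms by (auto simp: red_domain_def z n)
  have "(H_red m1 m2 m3 \<omega> has_derivative H') (at z)"
    unfolding H_red_def V_red_def n[symmetric] case_prod_beta z divide_inverse
    using sn
    by (auto intro!: derivative_eq_intros has_derivative_cot
        simp: H'_def abc case_prod_beta algebra_simps fun_eq_iff)
  moreover have "H' (ham_field (H_red m1 m2 m3 \<omega>) z) = 0"
    using ham_field_H_red[of q1 q2 p1 p2 m1 m2 m3 \<omega>] assms
    by (simp add: z H'_def abc n algebra_simps divide_inverse)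
  ultimately show ?thesis using that by blast
qed

theorem theorem3:
  fixes m1 m2 m3 \<alpha> \<beta> \<omega> :: real
  assumes "m1 > 0" and "m2 > 0" and "m3 > 0"
    and "0 < \<alpha>" and "\<alpha> < pi" and "0 < \<beta>" and "\<beta> < pi"
    and "pi < \<alpha> + \<beta>" and "\<alpha> + \<beta> < 2 * pi"
    and "fixed_point m1 m2 m3 (equator_pt 0, equator_pt \<alpha>, equator_pt (\<alpha> + \<beta>))"
    and "\<omega> \<noteq> 0"
  shows "lyapunov_stable (ham_field (H_red m1 m2 m3 \<omega>)) (red_domain m1 m2)
           (\<alpha>, \<beta> + nu1 m1 m2 * \<alpha>, 0, 0)"
proof -
  define n1 n2 where n: "n1 = nu1 m1 m2" "n2 = nu2 m1 m2"
  define z0 where "z0 = (\<alpha>, \<beta> + n1 * \<alpha>, 0::real, 0::real)"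
  have n12: "n1 + n2 = 1"
    using assms(1,2) by (simp add: n nu1_def nu2_def flip: add_divide_distrib)
  \<comment> \<open>The potential thus depends on the two angles a = q1 and b = q2 - n1 q1, which
    are \<alpha> and \<beta> at the rest point.\<close>
  have sum: "q2 + n2 * q1 = q1 + (q2 - n1 * q1)" for q1 q2
  proof -
    have "q1 = (n1 + n2) * q1" using n12 by simp
    then show ?thesis by (simp add: algebra_simps)
  qed
  have sn: "sin \<alpha> > 0" "sin \<beta> > 0" "sin (\<alpha> + \<beta>) < 0"
    using assms sin_gt_zero sin_lt_zero by auto
  obtain k where k: "k > 0" "m1 * m2 = k * (sin \<alpha>)\<^sup>2" "m2 * m3 = k * (sin \<beta>)\<^sup>2"
    "m1 * m3 = k * (sin (\<alpha> + \<beta>))\<^sup>2"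
    using fixed_point_equatorial_masses[of m1 m3 \<alpha> \<beta> m2] assms by blast
  have sum0: "\<beta> + n1 * \<alpha> + n2 * \<alpha> = \<alpha> + \<beta>"
    using sum[of "\<beta> + n1 * \<alpha>" \<alpha>] by simp
  have z0: "z0 \<in> red_domain m1 m2"
    using sn by (simp add: z0_def red_domain_def sum0 flip: n)
  obtain r L where r: "r > 0" "cball z0 r \<subseteq> red_domain m1 m2"
    "L-lipschitz_on (cball z0 r) (ham_field (H_red m1 m2 m3 \<omega>))"
    using ham_field_H_red_locally_lipschitz[OF z0] by blast
  \<comment> \<open>The acute configurations, where the strict maximum property is available; S is
    open, so a small ball around z0 fits into it.\<close>
  define S :: "state set" where "S = {z. 0 < fst z \<and> fst z < pi \<and>
      0 < fst (snd z) - n1 * fst z \<and> fst (snd z) - n1 * fst z < pi \<and>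
      pi < fst (snd z) + n2 * fst z \<and> fst (snd z) + n2 * fst z < 2 * pi}"
  have "open S"
    unfolding S_def by (intro open_Collect_conj open_Collect_less continuous_intros)
  moreover have "z0 \<in> S" using assms by (simp add: S_def z0_def sum0)
  ultimately obtain r' where r': "r' > 0" "cball z0 r' \<subseteq> S"
    using open_contains_cball by blast
  define \<rho> where "\<rho> = min r r'"
  have \<rho>: "\<rho> > 0" "cball z0 \<rho> \<subseteq> cball z0 r" "cball z0 \<rho> \<subseteq> S"
    using r r' by (auto simp: \<rho>_def)
  have nu: "nu3 m1 m2 > 0" "nu4 m1 m2 m3 > 0"
    using assms(1-3) by (auto simp: nu3_def nu4_def mbar_def)
  have V: "V_red m1 m2 m3 q1 q2 = k * ((sin \<alpha>)\<^sup>2 * cot q1 + (sin \<beta>)\<^sup>2 * cot (q2 - n1 * q1)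
      - (sin (\<alpha> + \<beta>))\<^sup>2 * cot (q1 + (q2 - n1 * q1)))" for q1 q2
    unfolding V_red_def n[symmetric] k sum by (simp add: algebra_simps)
  have "\<exists>H'. (H_red m1 m2 m3 \<omega> has_derivative H') (at z) \<and>
      H' (ham_field (H_red m1 m2 m3 \<omega>) z) = 0" if "z \<in> cball z0 \<rho>" for z
  proof -
    have "z \<in> red_domain m1 m2" using that \<rho>(2) r(2) by blast
    then show ?thesis by (rule H_red_derivative_along_ham_field) blast
  qed
  then obtain H' where H': "\<And>z. z \<in> cball z0 \<rho> \<Longrightarrow> (H_red m1 m2 m3 \<omega> has_derivative H' z) (at z)"
    "\<And>z. z \<in> cball z0 \<rho> \<Longrightarrow> H' z (ham_field (H_red m1 m2 m3 \<omega>) z) = 0"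
    by metis
  have cancel: "k * (sin t)\<^sup>2 * inverse ((sin t)\<^sup>2) = k"
    "k * (sin t)\<^sup>2 * c * inverse ((sin t)\<^sup>2) = k * c" if "sin t \<noteq> 0" for t c
    using that by simp_all
  \<comment> \<open>Replacing each mass product by k times a squared sine cancels all sines; what
    remains vanishes because n1 + n2 = 1.\<close>
  have "ham_field (H_red m1 m2 m3 \<omega>) z0 = (0, 0, k * n1 + k * n2 - k, k - k)"
    using ham_field_H_red[of \<alpha> "\<beta> + n1 * \<alpha>" 0 0 m1 m2 m3 \<omega>] z0 sn
    unfolding z0_def n[symmetric] k by (simp add: sum0 cancel)
  also have "\<dots> = 0" using n12 by (simp add: zero_prod_def flip: distrib_left)
  finally have "ham_field (H_red m1 m2 m3 \<omega>) z0 = 0" .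
  moreover have "H_red m1 m2 m3 \<omega> z0 < H_red m1 m2 m3 \<omega> z" if z: "z \<in> cball z0 \<rho>" "z \<noteq> z0" for z
  proof -
    obtain q1 q2 p1 p2 where zq: "z = (q1, q2, p1, p2)" by (cases z)
    define b where "b = q2 - n1 * q1"
    define K where "K = (p1\<^sup>2 / nu3 m1 m2 + p2\<^sup>2 / nu4 m1 m2 m3) / 2"
    define W where "W a b = (sin \<alpha>)\<^sup>2 * cot a + (sin \<beta>)\<^sup>2 * cot b
      - (sin (\<alpha> + \<beta>))\<^sup>2 * cot (a + b)" for a b
    have H: "H_red m1 m2 m3 \<omega> z = K - k * W q1 b + mbar m1 m2 m3 * \<omega>\<^sup>2 / 2"
      "H_red m1 m2 m3 \<omega> z0 = - (k * W \<alpha> \<beta>) + mbar m1 m2 m3 * \<omega>\<^sup>2 / 2"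
      by (simp_all add: H_red_def zq z0_def V W_def K_def b_def)
    have K0: "K \<ge> 0" using nu by (simp add: K_def)
    show ?thesis
    \<comment> \<open>At the rest angles some momentum is nonzero and the kinetic energy is
      positive; at other angles the potential is strictly below its maximum.\<close>
    proof (cases "(q1, b) = (\<alpha>, \<beta>)")
      case True
      then have "p1 \<noteq> 0 \<or> p2 \<noteq> 0" using z(2) by (auto simp: zq z0_def b_def)
      then have "K > 0" using nu by (auto simp: K_def intro: add_pos_nonneg add_nonneg_pos)
      then show ?thesis using True H by simp
    next
      case False
      have "z \<in> S" using \<rho> z by blast
      then have "W q1 b < W \<alpha> \<beta>"
        unfolding W_def using assms(4-9) False
        by (intro cot_sum_strict_max) (auto simp: S_def zq sum b_def)
      then have "k * W q1 b < k * W \<alpha> \<beta>" using k(1) by simp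
      then show ?thesis using H K0 by simp
    qed
  qed
  ultimately have "lyapunov_stable (ham_field (H_red m1 m2 m3 \<omega>)) (red_domain m1 m2) z0"
    using \<rho> r H' lipschitz_on_subset[OF r(3) \<rho>(2)]
    by (intro lyapunov_stable_if_strict_min_conserved[of \<rho> z0 _ _ L "H_red m1 m2 m3 \<omega>" H']) auto
  then show ?thesis by (simp add: z0_def n)
qed

end
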